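(* Let $N\in\mathbb{N}$, $N\ge 2$, and $m\in\{1,2,\ldots,N-1\}$. Suppose there is a monotone (nondecreasing) real sequence $\Gamma=(\gamma_0,\gamma_1,\ldots,\gamma_N)$ with $\gamma_0=1$ such that $$V_i(x)\le \gamma_i V_1(x)=\gamma_i\min_{u\in\mathbb{U}:\,f(x,u)\in\mathbb{X}}\ell(x,u)\qquad\text{for all }x\in\mathbb{X}\text{ and all } i\in\{1,\ldots,N\}.$$ Assume that $$\alpha=\alpha_{N,m}:=1-\frac{\prod_{i=m+1}^N(\gamma_i-1)\ \prod_{i=N-m+1}^N(\gamma_i-1)}{\Big[\prod_{i=m+1}^N\gamma_i-\prod_{i=m+1}^N(\gamma_i-1)\Big]\Big[\prod_{i=N-m+1}^N\gamma_i-\prod_{i=N-m+1}^N(\gamma_i-1)\Big]}$$ satisfies $\alpha>0$. Then, with $\mu=\mu_{N,m}$ the MPC multistep feedback, for each $x\in\mathbb{X}$, $$V_N(x_\mu(m;x))\le V_N(x)-\alpha\sum_{n=0}^{m-1}\ell(x_\mu(n;x),\mu(x,n)),$$ and the MPC closed loop satisfies, for each $x\in\mathbb{X}$, the performance estimate $$J_\infty^{\mu_{N,m}}(x)\le\frac1\alpha V_\infty(x).$$ If, in addition, there exist $\mathcal{K}_\infty$-functions $\underline\eta,\bar\eta$ such that $\underline\eta(d_X(x,x^\star))\le V_1(x)$ and $V_N(x)\le\bar\eta(d_X(x,x^\star))$ for all $x\in\mathbb{X}$, then the MPC closed loop asymptotically converges to $x^\star$, i.e. $x_{\mu}(n;x)\to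 x^\star$ as $n\to\infty$ for each $x\in\mathbb{X}$.
   Context: Setting. $(X,d_X)$ and $(U,d_U)$ are metric spaces, $f:X\times U\to X$, and the control system is $x(n+1)=f(x(n),u(n))$. $\mathbb{X}\subseteq X$ and $\mathbb{U}\subseteq U$ are constraint sets. For $x\in\mathbb{X}$ and a control sequence $u$, $x_u(\cdot;x)$ denotes the trajectory with $x_u(0;x)=x$, $x_u(n+1;x)=f(x_u(n;x),u(n))$. $\mathcal{U}^N(x)$ is the set of admissible control sequences $(u(0),\ldots,u(N-1))$, i.e. those with $u(n)\in\mathbb{U}$ and $f(x_u(n;x),u(n))\in\mathbb{X}$ for $n=0,\ldots,N-1$; $\mathcal{U}^\infty(x)$ is defined analogously for infinite sequences. $x^\star\in\mathbb{X}$ is a controlled equilibrium: $f(x^\star,u^\star)=x^\star$ for some control value $u^\star$. The stage cost $\ell:X\times U\to[0,\infty)$ is continuous with $\ell(x^\star,u^\star)=0$ and $\ell(x,u)>0$ for all $u\in U$ and all $x\ne x^\star$. Value functions. $J_N(x,u)=\sum_{n=0}^{N-1}\ell(x_u(n;x),u(n))$, $V_N(x)=\inf_{u\in\mathcal{U}^N(x)}J_N(x,u)$, $V_\infty(x)=\inf_{u\in\mathcal{U}^\infty(x)}\sum_{n=0}^\infty\ell(x_u(n;x),u(n))\in[0,\infty]$. Standing assumption: for each $x\in\mathbb{X}$ and each $N\in\mathbb{N}$ the set $\mathcal{U}^N(x)$ is nonempty and a minimizer of $J_N(x,\cdot)$ over $\mathcal{U}^N(x)$ exists. MPC multistep feedback.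 For $N\ge2$ and $m\in\{1,\ldots,N-1\}$ choose for each $x\in\mathbb{X}$ a minimizer $u^\star(\cdot;x)\in\mathcal{U}^N(x)$ of $J_N(x,\cdot)$ and set $\mu_{N,m}(x,n)=u^\star(n;x)$, $n=0,\ldots,m-1$. With $\mu=\mu_{N,m}$ and $\varphi(n)=\max\{km: k\in\mathbb{N}_0,\ km\le n\}$, the closed loop is $x_\mu(0;x)=x$, $x_\mu(n+1;x)=f\big(x_\mu(n;x),\mu(x_\mu(\varphi(n);x),n-\varphi(n))\big)$, and its cost is $J_\infty^\mu(x)=\sum_{n=0}^\infty\ell\big(x_\mu(n;x),\mu(x_\mu(\varphi(n);x),n-\varphi(n))\big)$. A $\mathcal{K}_\infty$-function is a continuous, strictly increasing, unbounded $\rho:[0,\infty)\to[0,\infty)$ with $\rho(0)=0$. *)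

theory Defs
  imports "HOL-Analysis.Analysis"
begin

primrec traj :: "('x \<Rightarrow> 'u \<Rightarrow> 'x) \<Rightarrow> (nat \<Rightarrow> 'u) \<Rightarrow> 'x \<Rightarrow> nat \<Rightarrow> 'x" where
  "traj f u x 0 = x"
| "traj f u x (Suc n) = f (traj f u x n) (u n)"

text \<open>A control sequence of length N is represented by any function on the naturals;
  its values at arguments at least N are irrelevant, both here and in \<open>cost\<close> below.\<close>

definition admissible ::
    "('x \<Rightarrow> 'u \<Rightarrow> 'x) \<Rightarrow> 'x set \<Rightarrow> 'u set \<Rightarrow> nat \<Rightarrow> 'x \<Rightarrow> (nat \<Rightarrow> 'u) set" where
  "admissible f XX UU N x = {u. \<forall>n<N. u n \<in> UU \<and> f (traj f u x n) (u n) \<in> XX}"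

definition admissible_inf ::
    "('x \<Rightarrow> 'u \<Rightarrow> 'x) \<Rightarrow> 'x set \<Rightarrow> 'u set \<Rightarrow> 'x \<Rightarrow> (nat \<Rightarrow> 'u) set" where
  "admissible_inf f XX UU x = {u. \<forall>n. u n \<in> UU \<and> f (traj f u x n) (u n) \<in> XX}"

definition cost ::
    "('x \<Rightarrow> 'u \<Rightarrow> 'x) \<Rightarrow> ('x \<Rightarrow> 'u \<Rightarrow> real) \<Rightarrow> nat \<Rightarrow> 'x \<Rightarrow> (nat \<Rightarrow> 'u) \<Rightarrow> real" where
  "cost f l N x u = (\<Sum>n<N. l (traj f u x n) (u n))"

text \<open>The infimum below is a real one; it is meaningful when the cost is bounded below on a nonempty
  admissible set, which holds for nonnegative stage costs as soon as a minimizer exists.\<close>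

definition val ::
    "('x \<Rightarrow> 'u \<Rightarrow> 'x) \<Rightarrow> ('x \<Rightarrow> 'u \<Rightarrow> real) \<Rightarrow> 'x set \<Rightarrow> 'u set \<Rightarrow> nat \<Rightarrow> 'x \<Rightarrow> real" where
  "val f l XX UU N x = (INF u\<in>admissible f XX UU N x. cost f l N x u)"

definition val_inf ::
    "('x \<Rightarrow> 'u \<Rightarrow> 'x) \<Rightarrow> ('x \<Rightarrow> 'u \<Rightarrow> real) \<Rightarrow> 'x set \<Rightarrow> 'u set \<Rightarrow> 'x \<Rightarrow> ereal" where
  "val_inf f l XX UU x =
     (INF u\<in>admissible_inf f XX UU x. \<Sum>n. ereal (l (traj f u x n) (u n)))"

definition is_minimizer ::
    "('x \<Rightarrow> 'u \<Rightarrow> 'x) \<Rightarrow> ('x \<Rightarrow> 'u \<Rightarrow> real) \<Rightarrow> 'x set \<Rightarrow> 'u set \<Rightarrow> nat \<Rightarrow> 'x \<Rightarrow> (nat \<Rightarrow> 'u) \<Rightarrow> bool" where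
  "is_minimizer f l XX UU N x u \<longleftrightarrow>
     is_arg_min (cost f l N x) (\<lambda>v. v \<in> admissible f XX UU N x) u"

text \<open>Only the values \<open>\<mu> x n\<close> with \<open>x \<in> XX\<close> and \<open>n < m\<close> are constrained; the closed loop started
  in \<open>XX\<close> uses no others.\<close>

definition mpc_feedback ::
    "('x \<Rightarrow> 'u \<Rightarrow> 'x) \<Rightarrow> ('x \<Rightarrow> 'u \<Rightarrow> real) \<Rightarrow> 'x set \<Rightarrow> 'u set \<Rightarrow> nat \<Rightarrow> nat \<Rightarrow>
     ('x \<Rightarrow> nat \<Rightarrow> 'u) \<Rightarrow> bool" where
  "mpc_feedback f l XX UU N m \<mu> \<longleftrightarrow>
     (\<forall>x\<in>XX. \<exists>u. is_minimizer f l XX UU N x u \<and> (\<forall>n<m. \<mu> x n = u n))"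

definition last_update :: "nat \<Rightarrow> nat \<Rightarrow> nat" where
  "last_update m n = Max {k * m |k. k * m \<le> n}"

lemma last_update_le: "last_update m n \<le> n"
proof -
  have "{k * m |k. k * m \<le> n} \<subseteq> {..n}" by auto
  then have fin: "finite {k * m |k. k * m \<le> n}" by (rule finite_subset) simp
  have "0 \<in> {k * m |k. k * m \<le> n}" by (auto intro: exI[of _ 0])
  then have "last_update m n \<in> {k * m |k. k * m \<le> n}"
    unfolding last_update_def using Max_in[OF fin] by blast
  then show ?thesis by auto
qed

function closed_loop ::
    "('x \<Rightarrow> 'u \<Rightarrow> 'x) \<Rightarrow> nat \<Rightarrow> ('x \<Rightarrow> nat \<Rightarrow> 'u) \<Rightarrow> 'x \<Rightarrow> nat \<Rightarrow> 'x" where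
  "closed_loop f m \<mu> x 0 = x"
| "closed_loop f m \<mu> x (Suc n) =
     f (closed_loop f m \<mu> x n)
       (\<mu> (closed_loop f m \<mu> x (last_update m n)) (n - last_update m n))"
  by pat_completeness auto
termination
  by (relation "Wellfounded.measure (\<lambda>(f, m, \<mu>, x, n). n)") (auto simp: last_update_le less_Suc_eq_le)

definition closed_loop_cost ::
    "('x \<Rightarrow> 'u \<Rightarrow> 'x) \<Rightarrow> ('x \<Rightarrow> 'u \<Rightarrow> real) \<Rightarrow> nat \<Rightarrow> ('x \<Rightarrow> nat \<Rightarrow> 'u) \<Rightarrow> 'x \<Rightarrow> ereal" where
  "closed_loop_cost f l m \<mu> x =
     (\<Sum>n. ereal (l (closed_loop f m \<mu> x n)
                    (\<mu> (closed_loop f m \<mu> x (last_update m n)) (n - last_update m n))))"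

text \<open>Functions on the nonnegative reals are represented by functions on the reals that are constrained
  only on the nonnegative half-line.\<close>

definition K_infinity :: "(real \<Rightarrow> real) \<Rightarrow> bool" where
  "K_infinity \<rho> \<longleftrightarrow>
     \<rho> ` {0..} \<subseteq> {0..} \<and> continuous_on {0..} \<rho> \<and> strict_mono_on {0..} \<rho> \<and>
     \<not> bounded (\<rho> ` {0..}) \<and> \<rho> 0 = 0"

definition alpha :: "(nat \<Rightarrow> real) \<Rightarrow> nat \<Rightarrow> nat \<Rightarrow> real" where
  "alpha \<gamma> N m =
     1 - ((\<Prod>i=m+1..N. (\<gamma> i - 1)) * (\<Prod>i=N-m+1..N. (\<gamma> i - 1))) /
         (((\<Prod>i=m+1..N. \<gamma> i) - (\<Prod>i=m+1..N. (\<gamma> i - 1))) *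
          ((\<Prod>i=N-m+1..N. \<gamma> i) - (\<Prod>i=N-m+1..N. (\<gamma> i - 1))))"

lemma val_1_eq:
  "val f l XX UU 1 x = (INF u\<in>{u\<in>UU. f x u \<in> XX}. l x u)"
proof -
  have "cost f l 1 x ` admissible f XX UU 1 x = l x ` {u\<in>UU. f x u \<in> XX}" (is "?A = ?B")
  proof
    show "?A \<subseteq> ?B" by (auto simp: cost_def admissible_def)
    show "?B \<subseteq> ?A"
    proof
      fix r assume "r \<in> ?B"
      then obtain u where "u \<in> UU" "f x u \<in> XX" "r = l x u" by auto
      then show "r \<in> ?A"
        by (intro image_eqI[of _ _ "\<lambda>_. u"]) (auto simp: cost_def admissible_def)
    qed
  qed
  then show ?thesis by (simp add: val_def)
qed

end

theory Submission
  imports Defs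
begin

text \<open>
  Let \<open>\<lambda> n\<close> be the stage costs along an optimal trajectory of length \<open>N\<close>, \<open>T k\<close> the sum of the
  \<open>\<lambda> n\<close> with \<open>n \<ge> k\<close>, and \<open>\<nu>\<close> the optimal value at the state reached after \<open>m\<close> steps. By dynamic
  programming, \<open>T k \<le> \<gamma> (N - k) * \<lambda> k\<close> and \<open>\<nu> \<le> T m - T (m + j) + \<gamma> (N - j) * \<lambda> (m + j)\<close>.
  Since \<open>\<lambda> k = T k - T (k + 1)\<close>, these say that both \<open>D k = T k\<close> and
  \<open>D j = \<nu> - T m + T (m + j)\<close> contract from one index to the next by the factors \<open>(\<gamma> i - 1) / \<gamma> i\<close>.
  The first contraction bounds \<open>T m\<close> by a multiple of the cost of the first \<open>m\<close> steps, the second one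
  bounds \<open>\<nu> - T m\<close> by a multiple of \<open>T m\<close>, and the two constants multiply to \<open>1 - \<alpha>\<close>. This relaxed
  dynamic programming inequality telescopes along the closed loop.
\<close>

section \<open>Scalar inequalities behind \<open>alpha\<close>\<close>

lemma sum_lessThan_add:
  fixes g :: "nat \<Rightarrow> 'a::comm_monoid_add"
  shows "(\<Sum>i<a + b. g i) = (\<Sum>i<a. g i) + (\<Sum>i<b. g (a + i))"
  by (induction b) (simp_all add: add.assoc)

text \<open>Each hypothesis rearranges to \<open>g j * D (Suc j) \<le> (g j - 1) * D j\<close>, and
  these are chained. Only the nonnegative factors multiply inequalities, so the sign of
  \<open>D\<close> is free; this matters because \<nu> may lie below \<open>T m\<close> in the
  application.\<close>

lemma prod_contraction:
  fixes D g :: "nat \<Rightarrow> real"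
  assumes g: "\<And>j. j < n \<Longrightarrow> 1 \<le> g j"
    and D: "\<And>j. j < n \<Longrightarrow> D j \<le> g j * (D j - D (Suc j))"
  shows "(\<Prod>j<n. g j) * D n \<le> (\<Prod>j<n. g j - 1) * D 0"
  using assms
proof (induction n)
  case 0
  then show ?case by simp
next
  case (Suc n)
  have IH: "(\<Prod>j<n. g j) * D n \<le> (\<Prod>j<n. g j - 1) * D 0"
    using Suc by simp
  have pos: "0 \<le> (\<Prod>j<n. g j)"
    by (intro prod_nonneg) (auto intro: order_trans[OF zero_le_one Suc.prems(1)])
  have step: "g n * D (Suc n) \<le> (g n - 1) * D n"
    using Suc.prems(2)[of n] by (simp add: algebra_simps)
  have "(\<Prod>j<Suc n. g j) * D (Suc n) = (\<Prod>j<n. g j) * (g n * D (Suc n))"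
    by (simp add: mult.assoc)
  also have "\<dots> \<le> (\<Prod>j<n. g j) * ((g n - 1) * D n)"
    by (rule mult_left_mono[OF step pos])
  also have "\<dots> = (g n - 1) * ((\<Prod>j<n. g j) * D n)"
    by (simp add: mult_ac)
  also have "\<dots> \<le> (g n - 1) * ((\<Prod>j<n. g j - 1) * D 0)"
    using Suc.prems(1)[of n] by (intro mult_left_mono IH) simp
  also have "\<dots> = (\<Prod>j<Suc n. g j - 1) * D 0"
    by (simp add: mult_ac)
  finally show ?case .
qed

text \<open>The contraction runs through shrinking horizons \<open>N - j\<close>, while
  \<open>alpha\<close> indexes its products upwards.\<close>

lemma prod_rev_atLeastAtMost:
  fixes h :: "nat \<Rightarrow> 'a::comm_monoid_mult"
  assumes "n \<le> N"
  shows "(\<Prod>j<n. h (N - j)) = (\<Prod>i=N-n+1..N. h i)"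
  by (rule prod.reindex_bij_witness[of _ "\<lambda>i. N - i" "\<lambda>j. N - j"]) (use assms in auto)

text \<open>Makes the two brackets in the denominator of \<open>alpha\<close> positive; their index
  ranges are nonempty because 1 \<le> m < N.\<close>

lemma prod_minus_one_bounds:
  fixes g :: "'a \<Rightarrow> real"
  assumes "finite A" "A \<noteq> {}" "\<And>i. i \<in> A \<Longrightarrow> 1 \<le> g i"
  shows "0 \<le> (\<Prod>i\<in>A. g i - 1)" and "(\<Prod>i\<in>A. g i - 1) < (\<Prod>i\<in>A. g i)"
proof -
  show "0 \<le> (\<Prod>i\<in>A. g i - 1)"
    by (intro prod_nonneg) (use assms(3) in force)
  show "(\<Prod>i\<in>A. g i - 1) < (\<Prod>i\<in>A. g i)"
  proof -
    obtain a where "a \<in> A" using assms(2) by blast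
    then show ?thesis
      by (rule prod_mono_strict) (use assms in \<open>force+\<close>)
  qed
qed

text \<open>Pure arithmetic, with the control system stripped away. In the application
  \<open>tail\<close> expresses optimality of end pieces, and \<open>next_val\<close> the cost of
  following the old controls for \<open>j\<close> more steps before restarting.\<close>

lemma relaxed_dp_estimate:
  fixes \<Lambda> \<gamma> :: "nat \<Rightarrow> real" and \<nu> :: real
  assumes m: "1 \<le> m" "m < N"
    and \<gamma>: "\<And>i. i \<in> {1..N} \<Longrightarrow> 1 \<le> \<gamma> i"
    and tail: "\<And>k. k < N \<Longrightarrow> (\<Sum>n=k..<N. \<Lambda> n) \<le> \<gamma> (N - k) * \<Lambda> k"
    and next_val: "\<And>j. j < N - m \<Longrightarrow> \<nu> \<le> (\<Sum>n=m..<m+j. \<Lambda> n) + \<gamma> (N - j) * \<Lambda> (m + j)"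
  shows "\<nu> \<le> (\<Sum>n<N. \<Lambda> n) - alpha \<gamma> N m * (\<Sum>n<m. \<Lambda> n)"
proof -
  define T where "T k = (\<Sum>n=k..<N. \<Lambda> n)" for k
  define S where "S = (\<Sum>n<m. \<Lambda> n)"
  have \<Lambda>_eq: "\<Lambda> k = T k - T (Suc k)" if "k < N" for k
    using that by (simp add: T_def sum.atLeast_Suc_lessThan)
  have T0: "T 0 = S + T m"
    using m sum.atLeastLessThan_concat[of 0 m N \<Lambda>]
    by (simp add: T_def S_def atLeast0LessThan)
  have Tdiff: "(\<Sum>n=m..<m+j. \<Lambda> n) = T m - T (m + j)" if "m + j \<le> N" for j
    using sum.atLeastLessThan_concat[of m "m + j" N \<Lambda>] that by (simp add: T_def)

  define P where "P = (\<Prod>i=N-m+1..N. \<gamma> i)"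
  define Q where "Q = (\<Prod>i=N-m+1..N. \<gamma> i - 1)"
  define P' where "P' = (\<Prod>i=m+1..N. \<gamma> i)"
  define Q' where "Q' = (\<Prod>i=m+1..N. \<gamma> i - 1)"
  have PQ: "0 \<le> Q" "Q < P"
    using m \<gamma> prod_minus_one_bounds[of "{N-m+1..N}" \<gamma>] by (auto simp: P_def Q_def)
  have PQ': "0 \<le> Q'" "Q' < P'"
    using m \<gamma> prod_minus_one_bounds[of "{m+1..N}" \<gamma>] by (auto simp: P'_def Q'_def)

  have "(\<Prod>j<m. \<gamma> (N - j)) * T m \<le> (\<Prod>j<m. \<gamma> (N - j) - 1) * T 0"
  proof (rule prod_contraction)
    fix j assume "j < m"
    then have "j < N" "N - j \<in> {1..N}" using m by auto
    then show "1 \<le> \<gamma> (N - j)" and "T j \<le> \<gamma> (N - j) * (T j - T (Suc j))"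
      using \<gamma> tail[of j] \<Lambda>_eq[of j] by (simp_all add: T_def)
  qed
  then have "P * T m \<le> Q * T 0"
    using m prod_rev_atLeastAtMost[of m N \<gamma>] prod_rev_atLeastAtMost[of m N "\<lambda>i. \<gamma> i - 1"]
    by (simp add: P_def Q_def)
  then have "T m * (P - Q) \<le> Q * S"
    by (simp add: T0 algebra_simps)
  then have T_le: "T m \<le> Q / (P - Q) * S"
    using PQ by (simp add: pos_le_divide_eq)

  define D where "D j = \<nu> - T m + T (m + j)" for j
  have "(\<Prod>j<N-m. \<gamma> (N - j)) * D (N - m) \<le> (\<Prod>j<N-m. \<gamma> (N - j) - 1) * D 0"
  proof (rule prod_contraction)
    fix j assume j: "j < N - m"
    then have "N - j \<in> {1..N}" by auto
    then show "1 \<le> \<gamma> (N - j)" using \<gamma> by blast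
    \<comment> \<open>By \<open>Tdiff\<close>, \<open>next_val\<close> says that \<open>D j\<close>
      is at most \<open>\<gamma> (N - j) * \<Lambda> (m + j)\<close>, and this \<Lambda> is the
      increment \<open>D j - D (Suc j)\<close>.\<close>
    show "D j \<le> \<gamma> (N - j) * (D j - D (Suc j))"
      using next_val[OF j] Tdiff[of j] \<Lambda>_eq[of "m + j"] j by (simp add: D_def)
  qed
  moreover have "N - (N - m) + 1 = m + 1" using m by simp
  ultimately have "P' * D (N - m) \<le> Q' * D 0"
    using m prod_rev_atLeastAtMost[of "N - m" N \<gamma>]
      prod_rev_atLeastAtMost[of "N - m" N "\<lambda>i. \<gamma> i - 1"]
    by (simp add: P'_def Q'_def)
  \<comment> \<open>\<open>T N\<close> is an empty sum, and at index 0 the two copies of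
    \<open>T m\<close> cancel.\<close>
  moreover have "D (N - m) = \<nu> - T m" "D 0 = \<nu>"
    using m by (simp_all add: D_def T_def)
  ultimately have "(\<nu> - T m) * (P' - Q') \<le> Q' * T m"
    by (simp add: algebra_simps)
  then have "\<nu> - T m \<le> Q' / (P' - Q') * T m"
    using PQ' by (simp add: pos_le_divide_eq)
  also have "\<dots> \<le> Q' / (P' - Q') * (Q / (P - Q) * S)"
    using PQ' by (intro mult_left_mono T_le) simp
  also have "\<dots> = (1 - alpha \<gamma> N m) * S"
    by (simp add: alpha_def P_def Q_def P'_def Q'_def)
  finally have "\<nu> \<le> T 0 - alpha \<gamma> N m * S"
    by (simp add: T0 algebra_simps)
  then show ?thesis
    by (simp add: T_def S_def atLeast0LessThan)
qed

section \<open>Concatenation of trajectories and the block structure of the closed loop\<close>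

lemma traj_cong:
  assumes "\<And>i. i < n \<Longrightarrow> u i = v i"
  shows "traj f u x n = traj f v x n"
  using assms by (induction n) auto

lemma traj_add: "traj f u x (k + n) = traj f (\<lambda>i. u (k + i)) (traj f u x k) n"
  by (induction n) auto

lemma cost_add:
  "cost f l (k + M) x u = cost f l k x u + cost f l M (traj f u x k) (\<lambda>i. u (k + i))"
  by (simp add: cost_def sum_lessThan_add traj_add)

lemma cost_cong:
  assumes "\<And>i. i < n \<Longrightarrow> u i = v i"
  shows "cost f l n x u = cost f l n x v"
  unfolding cost_def
  by (rule sum.cong) (use assms traj_cong[of _ u v f x] in auto)

lemma admissible_cong:
  assumes "\<And>i. i < n \<Longrightarrow> u i = v i"
  shows "u \<in> admissible f XX UU n x \<longleftrightarrow> v \<in> admissible f XX UU n x"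
proof -
  have "traj f u x i = traj f v x i" if "i < n" for i
    using that assms by (intro traj_cong) auto
  then show ?thesis using assms by (auto simp: admissible_def)
qed

lemma admissible_add_iff:
  "u \<in> admissible f XX UU (k + M) x \<longleftrightarrow>
     u \<in> admissible f XX UU k x \<and>
     (\<lambda>i. u (k + i)) \<in> admissible f XX UU M (traj f u x k)"
proof -
  have split: "(\<forall>n<k + M. R n) \<longleftrightarrow> (\<forall>n<k. R n) \<and> (\<forall>n<M. R (k + n))" for R
    by (metis add_less_cancel_left le_add_diff_inverse not_less trans_less_add1)
  show ?thesis
    unfolding admissible_def mem_Collect_eq split by (simp add: traj_add)
qed

text \<open>Admissibility constrains successor states, which covers indices 1 to \<open>N\<close>;
  index 0 is the assumption on \<open>x\<close>.\<close>

lemma traj_in_constraint: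
  assumes "x \<in> XX" "u \<in> admissible f XX UU N x" "n \<le> N"
  shows "traj f u x n \<in> XX"
  using assms by (cases n) (auto simp: admissible_def)

lemma last_update_mult_add:
  assumes "n < m"
  shows "last_update m (k * m + n) = k * m"
  unfolding last_update_def
proof (rule Max_eqI)
  have "{j * m |j. j * m \<le> k * m + n} \<subseteq> {..k * m + n}" by auto
  then show "finite {j * m |j. j * m \<le> k * m + n}" by (rule finite_subset) simp
  fix y assume "y \<in> {j * m |j. j * m \<le> k * m + n}"
  then obtain j where j: "y = j * m" "j * m \<le> k * m + n" by auto
  have "j * m < Suc k * m" using j assms by simp
  then have "j \<le> k" using mult_less_cancel2 by (metis less_Suc_eq_le)
  then show "y \<le> k * m" using j by simp
qed auto

text \<open>Between updates the feedback acts as an open-loop control fixed at the block start. The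
  endpoint \<open>n = m\<close> is included, since reaching it uses only controls with index below
  \<open>m\<close>; it hands over to the next block.\<close>

lemma closed_loop_block:
  assumes "n \<le> m"
  shows "closed_loop f m \<mu> x (k * m + n) =
    traj f (\<mu> (closed_loop f m \<mu> x (k * m))) (closed_loop f m \<mu> x (k * m)) n"
  using assms by (induction n) (simp_all add: last_update_mult_add)

section \<open>Finite-horizon dynamic programming\<close>

locale optimal_control =
  fixes f :: "'x \<Rightarrow> 'u \<Rightarrow> 'x" and l :: "'x \<Rightarrow> 'u \<Rightarrow> real"
    and XX :: "'x set" and UU :: "'u set"
  assumes l_nonneg: "\<And>x u. 0 \<le> l x u"
    and minimizer_ex: "\<And>x M. x \<in> XX \<Longrightarrow> \<exists>u. is_minimizer f l XX UU M x u"
begin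

abbreviation "Adm \<equiv> admissible f XX UU"
abbreviation "J \<equiv> cost f l"
abbreviation "V \<equiv> val f l XX UU"

lemma cost_nonneg: "0 \<le> J M x u"
  by (simp add: cost_def sum_nonneg l_nonneg)

lemma val_le_cost:
  assumes "u \<in> Adm M x"
  shows "V M x \<le> J M x u"
  unfolding val_def
  \<comment> \<open>A real infimum is a lower bound only for a set bounded below; nonnegative stage
    costs provide the bound 0.\<close>
  by (rule cINF_lower[OF _ assms]) (auto intro!: bdd_belowI2 cost_nonneg)

lemma minimizer_iff:
  "is_minimizer f l XX UU M x u \<longleftrightarrow> u \<in> Adm M x \<and> J M x u = V M x"
proof
  assume "is_minimizer f l XX UU M x u"
  then have u: "u \<in> Adm M x" and min: "\<And>v. v \<in> Adm M x \<Longrightarrow> J M x u \<le> J M x v"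
    by (auto simp: is_minimizer_def is_arg_min_linorder)
  have "J M x u \<le> V M x"
    unfolding val_def using u min by (intro cINF_greatest) auto
  then show "u \<in> Adm M x \<and> J M x u = V M x"
    using u val_le_cost[OF u] by simp
next
  assume "u \<in> Adm M x \<and> J M x u = V M x"
  then show "is_minimizer f l XX UU M x u"
    by (auto simp: is_minimizer_def is_arg_min_linorder val_le_cost)
qed

lemma val_nonneg:
  assumes "x \<in> XX"
  shows "0 \<le> V M x"
  using minimizer_ex[OF assms, of M] cost_nonneg by (metis minimizer_iff)

lemma val_1_le:
  assumes "u \<in> UU" "f x u \<in> XX"
  shows "V 1 x \<le> l x u"
  using val_le_cost[of "\<lambda>_. u" 1 x] assms by (simp add: admissible_def cost_def)

text \<open>The suboptimality half of Bellman's principle: \<open>u\<close> for \<open>k\<close>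
  steps, followed by a minimizer from the state reached, is one competitor for horizon
  \<open>k + M\<close>.\<close>

lemma val_add_le:
  assumes x: "x \<in> XX" and u: "u \<in> Adm k x"
  shows "V (k + M) x \<le> J k x u + V M (traj f u x k)"
proof -
  have "traj f u x k \<in> XX"
    using traj_in_constraint[OF x u] by simp
  then obtain v where v: "v \<in> Adm M (traj f u x k)" "J M (traj f u x k) v = V M (traj f u x k)"
    using minimizer_ex minimizer_iff by metis
  define w where "w i = (if i < k then u i else v (i - k))" for i
  have w: "\<And>i. i < k \<Longrightarrow> w i = u i" "(\<lambda>i. w (k + i)) = v"
    by (auto simp: w_def)
  have traj_w: "traj f w x k = traj f u x k"
    by (rule traj_cong) (rule w)
  have "w \<in> Adm k x"
    using u admissible_cong[of k w u f XX UU x] w(1) by blast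
  then have "w \<in> Adm (k + M) x"
    using v(1) by (simp add: admissible_add_iff traj_w w(2))
  then have "V (k + M) x \<le> J (k + M) x w" by (rule val_le_cost)
  also have "\<dots> = J k x u + V M (traj f u x k)"
    using cost_cong[of k w u f l x] w(1) v(2) by (simp add: cost_add traj_w w(2))
  finally show ?thesis .
qed

text \<open>Truncating an infinite admissible control keeps it admissible and drops only nonnegative
  costs. If no infinite admissible control exists, the right side is infinite and the bound still
  holds.\<close>

lemma val_le_val_inf:
  assumes "x \<in> XX"
  shows "ereal (V M x) \<le> val_inf f l XX UU x"
  unfolding val_inf_def
proof (rule INF_greatest)
  fix u assume "u \<in> admissible_inf f XX UU x"
  then have "u \<in> Adm M x" by (auto simp: admissible_inf_def admissible_def)
  then have "ereal (V M x) \<le> ereal (J M x u)"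
    by (simp add: val_le_cost)
  also have "\<dots> = (\<Sum>n<M. ereal (l (traj f u x n) (u n)))"
    by (simp add: cost_def)
  also have "\<dots> \<le> (\<Sum>n. ereal (l (traj f u x n) (u n)))"
    by (rule sum_le_suminf) (auto simp: l_nonneg summable_ereal_pos)
  finally show "ereal (V M x) \<le> (\<Sum>n. ereal (l (traj f u x n) (u n)))" .
qed

end

section \<open>Decrease of the value function along the MPC closed loop\<close>

locale mpc = optimal_control f l XX UU
  for f :: "'x \<Rightarrow> 'u \<Rightarrow> 'x" and l :: "'x \<Rightarrow> 'u \<Rightarrow> real" and XX UU +
  fixes N m :: nat and \<gamma> :: "nat \<Rightarrow> real" and \<mu> :: "'x \<Rightarrow> nat \<Rightarrow> 'u"
  assumes m_pos: "1 \<le> m" and m_less: "m < N"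
    and gamma_ge: "\<And>i. i \<in> {1..N} \<Longrightarrow> 1 \<le> \<gamma> i"
    and gamma_bound: "\<And>x i. x \<in> XX \<Longrightarrow> i \<in> {1..N} \<Longrightarrow> V i x \<le> \<gamma> i * V 1 x"
    and alpha_pos: "0 < alpha \<gamma> N m"
    and feedback: "mpc_feedback f l XX UU N m \<mu>"
begin

lemma val_le_gamma_cost:
  assumes "x \<in> XX" "i \<in> {1..N}" "u \<in> UU" "f x u \<in> XX"
  shows "V i x \<le> \<gamma> i * l x u"
proof -
  have "V i x \<le> \<gamma> i * V 1 x" by (rule gamma_bound[OF assms(1,2)])
  also have "\<dots> \<le> \<gamma> i * l x u"
    using gamma_ge[OF assms(2)] by (intro mult_left_mono val_1_le assms) simp
  finally show ?thesis .
qed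

lemma minimizer_decrease:
  assumes x: "x \<in> XX" and u: "u \<in> Adm N x" and opt: "J N x u = V N x"
  shows "V N (traj f u x m) \<le> V N x - alpha \<gamma> N m * (\<Sum>n<m. l (traj f u x n) (u n))"
proof -
  define \<Lambda> where "\<Lambda> n = l (traj f u x n) (u n)" for n
  have XX: "traj f u x n \<in> XX" if "n \<le> N" for n
    using traj_in_constraint[OF x u that] .
  have val_le: "V i (traj f u x n) \<le> \<gamma> i * \<Lambda> n" if "n < N" "i \<in> {1..N}" for i n
    unfolding \<Lambda>_def using that u XX[of n]
    by (intro val_le_gamma_cost) (auto simp: admissible_def)
  have adm: "(\<lambda>i. u (k + i)) \<in> Adm j (traj f u x k)" if "k + j \<le> N" for k j
  proof -
    have "u \<in> Adm (k + j) x" using u that by (auto simp: admissible_def)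
    then show ?thesis by (simp add: admissible_add_iff)
  qed
  have J_tail: "J j (traj f u x k) (\<lambda>i. u (k + i)) = (\<Sum>n=k..<k+j. \<Lambda> n)" for j k
  proof -
    have "J j (traj f u x k) (\<lambda>i. u (k + i)) = (\<Sum>n<j. \<Lambda> (k + n))"
      by (simp add: cost_def \<Lambda>_def traj_add)
    then show ?thesis
      using sum.shift_bounds_nat_ivl[of \<Lambda> 0 k j] by (simp add: atLeast0LessThan add.commute)
  qed
  have "V N (traj f u x m) \<le> (\<Sum>n<N. \<Lambda> n) - alpha \<gamma> N m * (\<Sum>n<m. \<Lambda> n)"
  proof (rule relaxed_dp_estimate[OF m_pos m_less gamma_ge])
    fix k assume k: "k < N"
    then have "u \<in> Adm k x" using u by (auto simp: admissible_def)
    \<comment> \<open>Keeping the first \<open>k\<close> controls and restarting optimally cannot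
      beat \<open>u\<close>. The common cost of these steps cancels, leaving the tail bounded by
      \<open>V (N - k)\<close> at the state reached.\<close>
    then have "V (k + (N - k)) x \<le> J k x u + V (N - k) (traj f u x k)"
      by (rule val_add_le[OF x])
    moreover have "V (k + (N - k)) x = J k x u + (\<Sum>n=k..<N. \<Lambda> n)"
      using k opt cost_add[of f l k "N - k" x u] J_tail[of "N - k" k] by simp
    ultimately show "(\<Sum>n=k..<N. \<Lambda> n) \<le> \<gamma> (N - k) * \<Lambda> k"
      using val_le[of k "N - k"] k by (simp add: Suc_leI)
  next
    fix j assume j: "j < N - m"
    then have mj: "m + j < N" by simp
    \<comment> \<open>From the state after \<open>m\<close> steps, reuse \<open>j\<close> further
      controls of \<open>u\<close>, available because \<open>m + j < N\<close>, then restart with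
      horizon \<open>N - j\<close>; the total horizon is again \<open>N\<close>.\<close>
    have "V (j + (N - j)) (traj f u x m) \<le> J j (traj f u x m) (\<lambda>i. u (m + i)) +
        V (N - j) (traj f (\<lambda>i. u (m + i)) (traj f u x m) j)"
      using val_add_le[OF XX adm[OF less_imp_le[OF mj]]] m_less by simp
    also have "traj f (\<lambda>i. u (m + i)) (traj f u x m) j = traj f u x (m + j)"
      by (simp add: traj_add)
    finally show "V N (traj f u x m) \<le> (\<Sum>n=m..<m+j. \<Lambda> n) + \<gamma> (N - j) * \<Lambda> (m + j)"
      using val_le[of "m + j" "N - j"] j mj J_tail[of j m] by (simp add: Suc_leI)
  qed
  then show ?thesis
    using opt by (simp add: cost_def \<Lambda>_def)
qed

lemma feedback_admissible:
  assumes "x \<in> XX"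
  shows "\<mu> x \<in> Adm m x"
proof -
  obtain u where u: "u \<in> Adm N x" "\<forall>n<m. \<mu> x n = u n"
    using feedback assms by (auto simp: mpc_feedback_def minimizer_iff)
  then have "u \<in> Adm m x" using m_less by (auto simp: admissible_def)
  then show ?thesis using u(2) admissible_cong[of m "\<mu> x" u f XX UU x] by simp
qed

lemma feedback_decrease:
  assumes "x \<in> XX"
  shows "V N (traj f (\<mu> x) x m) \<le>
    V N x - alpha \<gamma> N m * (\<Sum>n<m. l (traj f (\<mu> x) x n) (\<mu> x n))"
proof -
  obtain u where u: "u \<in> Adm N x" "J N x u = V N x" "\<And>n. n < m \<Longrightarrow> \<mu> x n = u n"
    using feedback assms by (auto simp: mpc_feedback_def minimizer_iff)
  have "J m x (\<mu> x) = J m x u" "traj f (\<mu> x) x m = traj f u x m"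
    using u(3) by (auto intro: cost_cong traj_cong)
  then show ?thesis
    using minimizer_decrease[OF assms u(1,2)] by (simp add: cost_def)
qed

abbreviation X :: "'x \<Rightarrow> nat \<Rightarrow> 'x" where
  "X \<equiv> closed_loop f m \<mu>"

definition control :: "'x \<Rightarrow> nat \<Rightarrow> 'u" where
  "control x n = \<mu> (X x (last_update m n)) (n - last_update m n)"

lemma control_block:
  assumes "n < m"
  shows "control x (k * m + n) = \<mu> (X x (k * m)) n"
  using assms by (simp add: control_def last_update_mult_add)

lemma closed_loop_block_start_in_XX:
  assumes "x \<in> XX"
  shows "X x (k * m) \<in> XX"
proof (induction k)
  case 0
  then show ?case using assms by simp
next
  case (Suc k)
  have "X x (k * m + m) \<in> XX"
    unfolding closed_loop_block[OF order_refl]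
    using traj_in_constraint[OF Suc.IH feedback_admissible[OF Suc.IH]] by simp
  then show ?case by (simp add: add.commute)
qed

text \<open>Every time lies in some block, where the loop copies an admissible open-loop
  trajectory.\<close>

lemma closed_loop_admissible:
  assumes "x \<in> XX"
  shows "X x n \<in> XX" and "control x n \<in> UU"
proof -
  define k r where "k = n div m" and "r = n mod m"
  have n: "n = k * m + r" and r: "r < m"
    using m_pos by (simp_all add: k_def r_def)
  let ?y = "X x (k * m)"
  have y: "?y \<in> XX" using assms by (rule closed_loop_block_start_in_XX)
  note adm = feedback_admissible[OF y]
  show "X x n \<in> XX"
    unfolding n using traj_in_constraint[OF y adm, of r] r by (simp add: closed_loop_block)
  show "control x n \<in> UU"
    unfolding n using adm r by (simp add: control_block admissible_def)
qed

text \<open>Telescopes \<open>feedback_decrease\<close> over the update times. Keeping the terminal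
  value on the left carries the induction.\<close>

lemma closed_loop_blocks_decrease:
  assumes "x \<in> XX"
  shows "alpha \<gamma> N m * (\<Sum>n<K * m. l (X x n) (control x n)) + V N (X x (K * m)) \<le> V N x"
proof (induction K)
  case 0
  then show ?case by simp
next
  case (Suc K)
  let ?y = "X x (K * m)"
  have y: "?y \<in> XX" using assms by (rule closed_loop_block_start_in_XX)
  have Suc_K: "Suc K * m = K * m + m" by simp
  have "(\<Sum>n<Suc K * m. l (X x n) (control x n)) =
      (\<Sum>n<K * m. l (X x n) (control x n)) + (\<Sum>n<m. l (traj f (\<mu> ?y) ?y n) (\<mu> ?y n))"
    unfolding Suc_K sum_lessThan_add by (simp add: closed_loop_block control_block)
  moreover have "X x (Suc K * m) = traj f (\<mu> ?y) ?y m"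
    unfolding Suc_K by (simp add: closed_loop_block)
  ultimately show ?case
    using Suc.IH feedback_decrease[OF y] by (simp add: algebra_simps)
qed

lemma closed_loop_partial_cost_le:
  assumes "x \<in> XX"
  shows "(\<Sum>n<K. l (X x n) (control x n)) \<le> V N x / alpha \<gamma> N m"
proof -
  \<comment> \<open>The decrease is known only at update times, so the sum is padded to whole
    blocks; \<open>K \<le> K * m\<close> since \<open>m\<close> is positive.\<close>
  have "(\<Sum>n<K. l (X x n) (control x n)) \<le> (\<Sum>n<K * m. l (X x n) (control x n))"
    using m_pos by (intro sum_mono2) (auto simp: l_nonneg)
  moreover have "alpha \<gamma> N m * (\<Sum>n<K * m. l (X x n) (control x n)) \<le> V N x"
    using closed_loop_blocks_decrease[OF assms, of K]
      val_nonneg[OF closed_loop_block_start_in_XX[OF assms, of K], of N] by linarith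
  then have "(\<Sum>n<K * m. l (X x n) (control x n)) \<le> V N x / alpha \<gamma> N m"
    using alpha_pos by (simp add: pos_le_divide_eq mult.commute)
  ultimately show ?thesis by linarith
qed

lemma closed_loop_cost_le:
  assumes "x \<in> XX"
  shows "closed_loop_cost f l m \<mu> x \<le> ereal (1 / alpha \<gamma> N m) * val_inf f l XX UU x"
proof -
  have "closed_loop_cost f l m \<mu> x = (\<Sum>n. ereal (l (X x n) (control x n)))"
    by (simp add: closed_loop_cost_def control_def)
  also have "\<dots> \<le> ereal (V N x / alpha \<gamma> N m)"
    by (rule suminf_bound)
      (auto simp: l_nonneg closed_loop_partial_cost_le[OF assms])
  also have "\<dots> = ereal (1 / alpha \<gamma> N m) * ereal (V N x)"
    by simp
  also have "\<dots> \<le> ereal (1 / alpha \<gamma> N m) * val_inf f l XX UU x"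
    using alpha_pos by (intro ereal_mult_left_mono val_le_val_inf assms) simp
  finally show ?thesis .
qed

text \<open>The bounded partial costs make the stage costs summable, hence null, and each dominates
  \<open>V 1\<close> because the applied control is admissible for one step.\<close>

lemma val_1_closed_loop_tendsto_0:
  assumes "x \<in> XX"
  shows "(\<lambda>n. V 1 (X x n)) \<longlonglongrightarrow> 0"
proof (rule real_tendsto_sandwich[where f = "\<lambda>_. 0" and h = "\<lambda>n. l (X x n) (control x n)"])
  have "summable (\<lambda>n. l (X x n) (control x n))"
    by (rule summableI_nonneg_bounded[OF l_nonneg closed_loop_partial_cost_le[OF assms]])
  then show "(\<lambda>n. l (X x n) (control x n)) \<longlonglongrightarrow> 0"
    by (rule summable_LIMSEQ_zero)
  have "f (X x n) (control x n) \<in> XX" for n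
    using closed_loop_admissible(1)[OF assms, of "Suc n"] by (simp add: control_def)
  then show "\<forall>\<^sub>F n in sequentially. V 1 (X x n) \<le> l (X x n) (control x n)"
    using closed_loop_admissible[OF assms] by (intro always_eventually allI val_1_le) auto
  show "\<forall>\<^sub>F n in sequentially. 0 \<le> V 1 (X x n)"
    using closed_loop_admissible[OF assms] by (intro always_eventually allI val_nonneg)
qed simp

end

section \<open>Convergence to the equilibrium and assembly of the theorem\<close>

lemma K_infinity_tendsto_0_cancel:
  assumes \<eta>: "K_infinity \<eta>" and d: "\<And>n. 0 \<le> d n" and lim: "((\<lambda>n. \<eta> (d n)) \<longlongrightarrow> 0) F"
  shows "(d \<longlongrightarrow> 0) F"
proof (rule order_tendstoI)
  fix a :: real assume "a < 0"
  then show "\<forall>\<^sub>F n in F. a < d n"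
    using d by (intro always_eventually allI) (meson less_le_trans)
next
  fix a :: real assume "0 < a"
  have mono: "strict_mono_on {0..} \<eta>" and "\<eta> 0 = 0"
    using \<eta> by (auto simp: K_infinity_def)
  then have "0 < \<eta> a"
    using \<open>0 < a\<close> strict_mono_onD[OF mono, of 0 a] by simp
  \<comment> \<open>The image \<open>\<eta> a\<close> serves as threshold: strict monotonicity
    reflects the order, so values of \<eta> below it force arguments below \<open>a\<close>.\<close>
  from order_tendstoD(2)[OF lim this] show "\<forall>\<^sub>F n in F. d n < a"
  proof (rule eventually_mono)
    fix n assume "\<eta> (d n) < \<eta> a"
    then show "d n < a"
      using strict_mono_on_less[OF mono, of "d n" a] d[of n] \<open>0 < a\<close> by simp
  qed
qed

theorem theorem2:
  fixes f :: "'x::metric_space \<Rightarrow> 'u::metric_space \<Rightarrow> 'x"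
    and XX :: "'x set" and UU :: "'u set"
    and l :: "'x \<Rightarrow> 'u \<Rightarrow> real"
    and xs :: 'x and us :: 'u
    and N m :: nat
    and \<gamma> :: "nat \<Rightarrow> real"
    and \<mu> :: "'x \<Rightarrow> nat \<Rightarrow> 'u"
  assumes l_cont: "continuous_on UNIV (\<lambda>(x, u). l x u)"
    and l_nonneg: "\<And>x u. 0 \<le> l x u"
    and xs_in: "xs \<in> XX"
    and equilibrium: "f xs us = xs"
    and l_zero: "l xs us = 0"
    and l_pos: "\<And>x u. x \<noteq> xs \<Longrightarrow> 0 < l x u"
    and minimizer_ex: "\<And>x M. x \<in> XX \<Longrightarrow> \<exists>u. is_minimizer f l XX UU M x u"
    and N_ge: "2 \<le> N"
    and m_range: "m \<in> {1..N - 1}"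
    and gamma_mono: "mono_on {0..N} \<gamma>"
    and gamma_0: "\<gamma> 0 = 1"
    and gamma_bound:
      "\<And>x i. x \<in> XX \<Longrightarrow> i \<in> {1..N} \<Longrightarrow> val f l XX UU i x \<le> \<gamma> i * val f l XX UU 1 x"
    and alpha_pos: "0 < alpha \<gamma> N m"
    and feedback: "mpc_feedback f l XX UU N m \<mu>"
  shows "(\<forall>x\<in>XX. val f l XX UU N (closed_loop f m \<mu> x m)
            \<le> val f l XX UU N x - alpha \<gamma> N m * (\<Sum>n=0..m-1. l (closed_loop f m \<mu> x n) (\<mu> x n))) \<and>
         (\<forall>x\<in>XX. closed_loop_cost f l m \<mu> x
            \<le> ereal (1 / alpha \<gamma> N m) * val_inf f l XX UU x) \<and>
         ((\<exists>\<eta>l \<eta>u. K_infinity \<eta>l \<and> K_infinity \<eta>u \<and>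
             (\<forall>x\<in>XX. \<eta>l (dist x xs) \<le> val f l XX UU 1 x \<and> val f l XX UU N x \<le> \<eta>u (dist x xs)))
          \<longrightarrow> (\<forall>x\<in>XX. closed_loop f m \<mu> x \<longlonglongrightarrow> xs))"
proof -
  \<comment> \<open>Monotonicity starting from \<open>\<gamma> 0 = 1\<close> yields the lower bound
    that keeps all factors \<open>\<gamma> i - 1\<close> nonnegative.\<close>
  have gamma_ge: "1 \<le> \<gamma> i" if "i \<in> {1..N}" for i
    using mono_onD[OF gamma_mono, of 0 i] gamma_0 that by simp
  interpret mpc f l XX UU N m \<gamma> \<mu>
    using l_nonneg minimizer_ex N_ge m_range gamma_ge gamma_bound alpha_pos feedback
    by unfold_locales auto
  have decrease: "V N (X x m) \<le> V N x - alpha \<gamma> N m * (\<Sum>n=0..m-1. l (X x n) (\<mu> x n))"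
    if "x \<in> XX" for x
  proof -
    \<comment> \<open>This is block 0, which starts at \<open>x\<close> itself.\<close>
    have "X x n = traj f (\<mu> x) x n" if "n \<le> m" for n
      using closed_loop_block[OF that, of f \<mu> x 0] by simp
    moreover have "{0..m-1} = {..<m}" using m_pos by auto
    ultimately show ?thesis using feedback_decrease[OF that] by simp
  qed
  \<comment> \<open>The lower comparison function of the distance is squeezed between 0 and
    \<open>V 1\<close>, which vanishes along the loop.\<close>
  have conv: "X x \<longlonglongrightarrow> xs"
    if \<eta>: "K_infinity \<eta>" "\<And>y. y \<in> XX \<Longrightarrow> \<eta> (dist y xs) \<le> V 1 y" and x: "x \<in> XX" for \<eta> x
  proof -
    have "0 \<le> \<eta> (dist y xs)" for y
      using \<eta>(1) by (auto simp: K_infinity_def image_subset_iff)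
    moreover have "\<eta> (dist (X x n) xs) \<le> V 1 (X x n)" for n
      by (rule \<eta>(2)[OF closed_loop_admissible(1)[OF x]])
    ultimately have "(\<lambda>n. \<eta> (dist (X x n) xs)) \<longlonglongrightarrow> 0"
      by (intro tendsto_sandwich[OF _ _ tendsto_const val_1_closed_loop_tendsto_0[OF x]]
        always_eventually allI)
    then show ?thesis
      unfolding tendsto_dist_iff[of _ xs]
      by (rule K_infinity_tendsto_0_cancel[OF \<eta>(1) zero_le_dist])
  qed
  show ?thesis
  proof (intro conjI ballI impI)
    fix x assume x: "x \<in> XX"
    show "V N (X x m) \<le> V N x - alpha \<gamma> N m * (\<Sum>n=0..m-1. l (X x n) (\<mu> x n))"
      by (rule decrease[OF x])
    show "closed_loop_cost f l m \<mu> x \<le> ereal (1 / alpha \<gamma> N m) * val_inf f l XX UU x"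
      by (rule closed_loop_cost_le[OF x])
    assume "\<exists>\<eta>l \<eta>u. K_infinity \<eta>l \<and> K_infinity \<eta>u \<and>
      (\<forall>x\<in>XX. \<eta>l (dist x xs) \<le> V 1 x \<and> V N x \<le> \<eta>u (dist x xs))"
    then obtain \<eta> where "K_infinity \<eta>" "\<forall>y\<in>XX. \<eta> (dist y xs) \<le> V 1 y"
      by blast
    then show "X x \<longlonglongrightarrow> xs"
      by (intro conv[OF _ _ x]) auto
  qed
qed

end
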